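(* Let $t\in[T]$ and suppose that for every task $s\in\{1,\dots,t\}$ the matrix $\boldsymbol\Sigma_s$ has exactly $n_s$ positive eigenvalues (counted with multiplicity) and $n_s<p$, i.e. $|\{j\in[p]:\gamma_j^{(s)}>0\}|=n_s<p$. Then the minimum norm estimator $\widehat{\boldsymbol w}_t^{(\mathrm{MN})}$ satisfies $$\mathcal L(\widehat{\boldsymbol w}_t^{(\mathrm{MN})})\ \ge\ \frac{\sigma^2}{\max_{j\in[p]}\gamma_j^{(t)}} .$$
   Context: Setting (continual linear regression). There are $T$ tasks. Task $t\in[T]=\{1,\dots,T\}$ has $n_t\ge 1$ samples, a fixed (deterministic) design matrix $\boldsymbol X_t\in\mathbb R^{n_t\times p}$ and response vector $\boldsymbol y_t=\boldsymbol X_t\boldsymbol w_*+\boldsymbol\varepsilon_t\in\mathbb R^{n_t}$, where $\boldsymbol w_*\in\mathbb R^p$ is a fixed parameter common to all tasks, and the noise entries (over all samples and tasks) are independent with mean $0$ and variance $\sigma^2>0$. Put $\boldsymbol\Sigma_t=\boldsymbol X_t^\top\boldsymbol X_t/n_t\in\mathbb R^{p\times p}$, with eigenvalues $\gamma_1^{(t)},\dots,\gamma_p^{(t)}$ (with multiplicity). For an estimator $\widehat{\boldsymbol w}$, $\mathcal L(\widehat{\boldsymbol w})=\mathbb E\|\widehat{\boldsymbol w}-\boldsymbol w_*\|^2$ (Euclidean norm, expectation over the noise). Minimum norm estimator: $\widehat{\boldsymbol w}_0^{(\mathrm{MN})}=0$ and, for $t\ge1$, $\widehat{\boldsymbol w}_t^{(\mathrm{MN})}$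 is the minimizer of $\|\boldsymbol w-\widehat{\boldsymbol w}_{t-1}^{(\mathrm{MN})}\|^2$ over all $\boldsymbol w\in\mathbb R^p$ with $\boldsymbol X_t\boldsymbol w=\boldsymbol y_t$. *)

theory Defs
  imports "HOL-Probability.Probability" "Jordan_Normal_Form.Char_Poly"
begin

text \<open>Dimensions are given by carriers rather than types, since the number of rows of the design
  matrices depends on the task. Tasks are numbered from 1, samples of a task from 0.\<close>

definition gram_cov :: "real Matrix.mat \<Rightarrow> real Matrix.mat" where
  "gram_cov X = (1 / real (dim_row X)) \<cdot>\<^sub>m (transpose_mat X * X)"

text \<open>The real eigenvalues, each repeated according to its algebraic multiplicity. For symmetric
  matrices, such as \<^term>\<open>gram_cov X\<close>, these are all the eigenvalues, and algebraic and
  geometric multiplicities agree.\<close>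

definition eigvals :: "real Matrix.mat \<Rightarrow> real multiset" where
  "eigvals A = proots (char_poly A)"

definition sq_dist :: "real Matrix.vec \<Rightarrow> real Matrix.vec \<Rightarrow> real" where
  "sq_dist v w = (v - w) \<bullet> (v - w)"

definition response ::
  "(nat \<Rightarrow> real Matrix.mat) \<Rightarrow> real Matrix.vec \<Rightarrow> (nat \<Rightarrow> nat \<Rightarrow> 'a \<Rightarrow> real) \<Rightarrow> 'a \<Rightarrow> nat \<Rightarrow> real Matrix.vec"
where
  "response X w_star \<epsilon> \<omega> t = X t *\<^sub>v w_star + Matrix.vec (dim_row (X t)) (\<lambda>i. \<epsilon> t i \<omega>)"

text \<open>The minimiser exists and is unique whenever the constraint \<open>X\<^sub>t w = y\<^sub>t\<close> is feasible;
  otherwise the value is unspecified.\<close>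

primrec mn_estimator ::
  "nat \<Rightarrow> (nat \<Rightarrow> real Matrix.mat) \<Rightarrow> (nat \<Rightarrow> real Matrix.vec) \<Rightarrow> nat \<Rightarrow> real Matrix.vec"
where
  "mn_estimator p X y 0 = 0\<^sub>v p"
| "mn_estimator p X y (Suc t) =
     arg_min (\<lambda>w. sq_dist w (mn_estimator p X y t))
       (\<lambda>w. w \<in> carrier_vec p \<and> X (Suc t) *\<^sub>v w = y (Suc t))"

definition risk :: "'a measure \<Rightarrow> real Matrix.vec \<Rightarrow> ('a \<Rightarrow> real Matrix.vec) \<Rightarrow> real" where
  "risk M w_star what = prob_space.expectation M (\<lambda>\<omega>. sq_dist (what \<omega>) w_star)"

end

theory Submission
  imports Defs
begin

text \<open>Since the estimator interpolates task \<open>t\<close>, the error satisfies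
  \<open>X\<^sub>t (w\<^sub>t - w\<^sub>*) = \<epsilon>\<^sub>t\<close>. Hence \<open>\<parallel>\<epsilon>\<^sub>t\<parallel>\<^sup>2\<close> is \<open>n\<^sub>t\<close> times the quadratic form of \<open>\<Sigma>\<^sub>t\<close> at the error,
  which, for the largest eigenvalue \<open>\<gamma>\<close> of \<open>\<Sigma>\<^sub>t\<close>, is at most \<open>n\<^sub>t \<gamma> \<parallel>w\<^sub>t - w\<^sub>*\<parallel>\<^sup>2\<close>; taking expectations gives
  \<open>n\<^sub>t \<sigma>\<^sup>2 \<le> n\<^sub>t \<gamma> L\<close>. The eigenvalue condition makes \<open>X\<^sub>s X\<^sub>s\<^sup>T\<close> invertible, so every minimiser exists and
  is an affine function of the noise. This gives square integrability, without which the
  expectation would be the junk value 0.\<close>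

unbundle no vec_syntax
unbundle no inner_syntax

section \<open>Characteristic polynomials of products and the row Gram matrix\<close>

text \<open>Sylvester's determinant identity in polynomial form: both sides equal
  \<open>det L * x ^ m\<close> for one block matrix \<open>L\<close>. The powers of the
  indeterminate make up for the different sizes, so \<open>A * B\<close> and \<open>B * A\<close>
  have the same nonzero roots with multiplicity.\<close>

lemma char_poly_mult_swap:
  fixes A B :: "'a :: idom mat"
  assumes A: "A \<in> carrier_mat n m" and B: "B \<in> carrier_mat m n"
  shows "char_poly (A * B) * [:0, 1:] ^ m = [:0, 1:] ^ n * char_poly (B * A)"
proof -
  \<comment> \<open>Embedding scalars as constant polynomials is a ring homomorphism, so the image
    of \<open>A * B\<close> splits into the product \<open>A' * B'\<close> that the block
    computation needs.\<close>
  interpret c: comm_ring_hom "\<lambda>a :: 'a. [:a:]"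
    by unfold_locales (simp_all add: one_pCons)
  define x where "x = [:0, 1 :: 'a:]"
  define A' where "A' = map_mat (\<lambda>a. [:a:]) A"
  define B' where "B' = map_mat (\<lambda>a. [:a:]) B"
  have [simp]: "A' \<in> carrier_mat n m" "B' \<in> carrier_mat m n"
    using A B by (auto simp: A'_def B'_def)
  have [simp]: "dim_row A' = n" "dim_col A' = m" "dim_row B' = m" "dim_col B' = n"
    using A B by (auto simp: A'_def B'_def)
  have [simp]: "A' * B' \<in> carrier_mat n n" "B' * A' \<in> carrier_mat m m"
    by (auto intro: mult_carrier_mat[of _ _ m] mult_carrier_mat[of _ _ n])
  have cp: "char_poly_matrix (C * D) =
      x \<cdot>\<^sub>m 1\<^sub>m k - map_mat (\<lambda>a. [:a:]) C * map_mat (\<lambda>a. [:a:]) D"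
    if "C \<in> carrier_mat k l" "D \<in> carrier_mat l k" for C D :: "'a mat" and k l
    unfolding char_poly_matrix_def x_def c.mat_hom_mult[OF that, symmetric]
    using that by (intro eq_matI) auto
  \<comment> \<open>Eliminating either off-diagonal block of \<open>L\<close> by a column operation yields the two sides.\<close>
  define L where "L = four_block_mat (x \<cdot>\<^sub>m 1\<^sub>m n) A' B' (1\<^sub>m m)"
  define R1 where "R1 = four_block_mat (1\<^sub>m n) (0\<^sub>m n m) (- B') (1\<^sub>m m)"
  define R2 where "R2 = four_block_mat (1\<^sub>m n) (- A') (0\<^sub>m m n) (x \<cdot>\<^sub>m 1\<^sub>m m)"
  have Lc: "L \<in> carrier_mat (n + m) (n + m)" and R1c: "R1 \<in> carrier_mat (n + m) (n + m)"
    and R2c: "R2 \<in> carrier_mat (n + m) (n + m)"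
    by (auto simp: L_def R1_def R2_def)
  have "L * R1 = four_block_mat (x \<cdot>\<^sub>m 1\<^sub>m n - A' * B') A' (0\<^sub>m m n) (1\<^sub>m m)"
    unfolding L_def R1_def
    by (subst mult_four_block_mat[of _ n n _ m _ m _ _ n _ m];
      (intro arg_cong4[where f = four_block_mat])?; auto intro!: eq_matI)
  moreover have "det (four_block_mat (x \<cdot>\<^sub>m 1\<^sub>m n - A' * B') A' (0\<^sub>m m n) (1\<^sub>m m)) =
      det (x \<cdot>\<^sub>m 1\<^sub>m n - A' * B') * det (1\<^sub>m m)"
    by (rule det_four_block_mat_lower_left_zero) auto
  moreover have "det R1 = 1"
    unfolding R1_def by (subst det_four_block_mat_upper_right_zero[of _ n _ m]) auto
  ultimately have 1: "det L = char_poly (A * B)"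
    using det_mult[OF Lc R1c]
    by (simp add: char_poly_def cp[OF A B, folded A'_def B'_def])
  have "L * R2 = four_block_mat (x \<cdot>\<^sub>m 1\<^sub>m n) (0\<^sub>m n m) B' (x \<cdot>\<^sub>m 1\<^sub>m m - B' * A')"
    unfolding L_def R2_def
    by (subst mult_four_block_mat[of _ n n _ m _ m _ _ n _ m];
      (intro arg_cong4[where f = four_block_mat])?; auto intro!: eq_matI)
  moreover have "det (four_block_mat (x \<cdot>\<^sub>m 1\<^sub>m n) (0\<^sub>m n m) B' (x \<cdot>\<^sub>m 1\<^sub>m m - B' * A')) =
      det (x \<cdot>\<^sub>m 1\<^sub>m n) * det (x \<cdot>\<^sub>m 1\<^sub>m m - B' * A')"
    by (rule det_four_block_mat_upper_right_zero) auto
  moreover have "det R2 = x ^ m"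
    unfolding R2_def by (subst det_four_block_mat_lower_left_zero[of _ n _ m]) auto
  ultimately have 2: "det L * x ^ m = x ^ n * char_poly (B * A)"
    using det_mult[OF Lc R2c]
    by (simp add: char_poly_def cp[OF B A, folded A'_def B'_def])
  show ?thesis
    using 1 2 by (simp add: x_def)
qed

lemma set_eigvals:
  assumes "A \<in> carrier_mat n n"
  shows "set_mset (eigvals A) = {k. eigenvalue A k}"
proof -
  have "char_poly A \<noteq> 0"
    using degree_monic_char_poly[OF assms] by auto
  then show ?thesis
    by (simp add: eigvals_def eigenvalue_root_char_poly[OF assms])
qed

text \<open>With \<open>B\<close> the transpose of \<open>X\<close> scaled by \<open>1 / n\<close>,
  the matrix \<open>X * B\<close> inherits the positive eigenvalues of
  \<open>gram_cov X = B * X\<close>. Its characteristic polynomial has degree \<open>n\<close>, so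
  \<open>n\<close> positive roots exhaust it and leave no room for the root 0.\<close>

lemma det_row_gram_nonzero:
  assumes X: "X \<in> carrier_mat n p"
    and pos: "size {#\<gamma> \<in># eigvals (gram_cov X). \<gamma> > 0#} = n"
  shows "det (X * transpose_mat X) \<noteq> 0"
proof
  define B where "B = (1 / real n) \<cdot>\<^sub>m transpose_mat X"
  have B: "B \<in> carrier_mat p n"
    using X by (simp add: B_def)
  have XB: "X * B \<in> carrier_mat n n" and BX: "B * X \<in> carrier_mat p p"
    using X B by auto
  have gram: "gram_cov X = B * X"
    using X by (auto simp: gram_cov_def B_def)
  have nz: "char_poly (X * B) \<noteq> 0" "char_poly (B * X) \<noteq> 0"
    using degree_monic_char_poly[OF XB] degree_monic_char_poly[OF BX] by auto
  have [simp]: "{#\<gamma> \<in># replicate_mset k (0 :: real). \<gamma> > 0#} = {#}" for k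
    by simp
  have proots_x: "proots ([:0, 1:] ^ k) = replicate_mset k (0 :: real)" for k
    by (simp add: proots_power)
  have "proots (char_poly (X * B)) + replicate_mset p 0 =
      replicate_mset n 0 + proots (char_poly (B * X))"
    using arg_cong[OF char_poly_mult_swap[OF X B], of proots] nz
    by (simp add: proots_mult proots_x)
  \<comment> \<open>Filtering for positive roots removes the zeros contributed by the two powers of
    the indeterminate, so the counts for \<open>X * B\<close> and \<open>B * X\<close>
    agree.\<close>
  from arg_cong[OF this, of "filter_mset (\<lambda>\<gamma>. \<gamma> > 0)"]
  have "size {#\<gamma> \<in># proots (char_poly (X * B)). \<gamma> > 0#} = n"
    using pos by (simp add: gram eigvals_def)
  moreover have "size (proots (char_poly (X * B))) \<le> n"
    using size_proots_le[of "char_poly (X * B)"] degree_monic_char_poly[OF XB] by simp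
  ultimately have "{#\<gamma> \<in># proots (char_poly (X * B)). \<not> \<gamma> > 0#} = {#}"
    using multiset_partition[of "proots (char_poly (X * B))" "\<lambda>\<gamma>. \<gamma> > 0"]
    by (metis add_diff_cancel_left' diff_is_0_eq size_eq_0_iff_empty size_union)
  then have not0: "\<not> eigenvalue (X * B) 0"
    using nz(1) by (auto simp: eigenvalue_root_char_poly[OF XB])
  assume "det (X * transpose_mat X) = 0"
  moreover have "X * B = (1 / real n) \<cdot>\<^sub>m (X * transpose_mat X)"
    using X by (auto simp: B_def)
  ultimately have "det (X * B) = 0"
    by (simp add: X)
  then obtain v where "v \<in> carrier_vec n" "v \<noteq> 0\<^sub>v n" "(X * B) *\<^sub>v v = 0\<^sub>v n"
    using det_0_iff_vec_prod_zero_field[OF XB] by auto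
  then have "eigenvector (X * B) v 0"
    using XB by (auto simp: eigenvector_def)
  with not0 show False
    by (auto simp: eigenvalue_def)
qed

section \<open>Quadratic forms of real matrices and the largest eigenvalue\<close>

lemma scalar_prod_self_nonneg: "v \<bullet> v \<ge> (0 :: real)"
  by (auto simp: scalar_prod_def intro: sum_nonneg)

lemma scalar_prod_self_pos:
  fixes v :: "real vec"
  assumes "v \<in> carrier_vec n" "v \<noteq> 0\<^sub>v n"
  shows "v \<bullet> v > 0"
  using assms conjugate_square_greater_0_vec[of v n] by (simp add: conjugate_vec_def)

text \<open>Since each product of two entries of \<open>v\<close> is at most
  \<open>v \<bullet> v\<close> in absolute value, the sum of the absolute entries of
  \<open>A\<close> is a valid constant. Such a crude bound suffices: only its existence is used
  later.\<close>

lemma quadratic_form_bound: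
  fixes A :: "real mat"
  assumes A: "A \<in> carrier_mat n n"
  obtains C where "C > 0" "\<And>v. v \<in> carrier_vec n \<Longrightarrow> v \<bullet> (A *\<^sub>v v) \<le> C * (v \<bullet> v)"
proof
  \<comment> \<open>The summand 1 keeps \<open>C\<close> positive even when all entries vanish, so
    that \<open>1 / C\<close> can serve as a coercivity constant.\<close>
  define C where "C = 1 + (\<Sum>i<n. \<Sum>j<n. \<bar>A $$ (i, j)\<bar>)"
  show "C > 0"
    by (simp add: C_def add_pos_nonneg sum_nonneg)
  fix v :: "real vec"
  assume v: "v \<in> carrier_vec n"
  have sq: "(v $ i)\<^sup>2 \<le> v \<bullet> v" if "i < n" for i
  proof -
    have "(v $ i)\<^sup>2 = (\<Sum>j\<in>{i}. v $ j * v $ j)"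
      by (simp add: power2_eq_square)
    also have "\<dots> \<le> v \<bullet> v"
      unfolding scalar_prod_def using that v by (intro sum_mono2) auto
    finally show ?thesis .
  qed
  have entry: "v $ i * A $$ (i, j) * v $ j \<le> \<bar>A $$ (i, j)\<bar> * (v \<bullet> v)"
    if "i < n" "j < n" for i j
  proof -
    have "2 * \<bar>v $ i * v $ j\<bar> \<le> (v $ i)\<^sup>2 + (v $ j)\<^sup>2"
      using sum_squares_bound[of "\<bar>v $ i\<bar>" "\<bar>v $ j\<bar>"] by (simp add: abs_mult)
    then have "\<bar>v $ i * v $ j\<bar> \<le> v \<bullet> v"
      using sq[OF that(1)] sq[OF that(2)] by linarith
    then have "\<bar>A $$ (i, j)\<bar> * \<bar>v $ i * v $ j\<bar> \<le> \<bar>A $$ (i, j)\<bar> * (v \<bullet> v)"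
      by (rule mult_left_mono) simp
    moreover have "v $ i * A $$ (i, j) * v $ j \<le> \<bar>v $ i * A $$ (i, j) * v $ j\<bar>"
      by simp
    ultimately show ?thesis
      by (simp add: abs_mult mult_ac)
  qed
  have "v \<bullet> (A *\<^sub>v v) = (\<Sum>i<n. \<Sum>j<n. v $ i * A $$ (i, j) * v $ j)"
    using A v by (simp add: scalar_prod_def sum_distrib_left atLeast0LessThan mult.assoc)
  also have "\<dots> \<le> (\<Sum>i<n. \<Sum>j<n. \<bar>A $$ (i, j)\<bar> * (v \<bullet> v))"
    by (intro sum_mono entry) auto
  also have "\<dots> = (\<Sum>i<n. \<Sum>j<n. \<bar>A $$ (i, j)\<bar>) * (v \<bullet> v)"
    by (simp add: sum_distrib_right)
  also have "\<dots> \<le> C * (v \<bullet> v)"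
    unfolding C_def by (intro mult_right_mono) (auto simp: scalar_prod_self_nonneg)
  finally show "v \<bullet> (A *\<^sub>v v) \<le> C * (v \<bullet> v)" .
qed

lemma mat_symmetric_form:
  fixes A :: "real mat"
  assumes "A \<in> carrier_mat n n" "transpose_mat A = A" "u \<in> carrier_vec n" "v \<in> carrier_vec n"
  shows "u \<bullet> (A *\<^sub>v v) = v \<bullet> (A *\<^sub>v u)"
  using transpose_vec_mult_scalar[of A n n v u] assms
  by (simp add: comm_scalar_prod[of _ n])

lemma mat_inverse_of_det_nonzero:
  fixes A :: "'a :: field mat"
  assumes "A \<in> carrier_mat n n" "det A \<noteq> 0"
  obtains B where "B \<in> carrier_mat n n" "A * B = 1\<^sub>m n"
  using det_non_zero_imp_unit[OF assms, of "()"] by (auto simp: Units_def ring_mat_def)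

text \<open>An algebraic replacement for compactness of the unit sphere: an upper bound
  \<open>C\<close> for the form of the inverse \<open>B\<close> turns into the lower bound
  \<open>1 / C\<close> for the form of \<open>S\<close>, by testing positivity at a single
  well-chosen vector.\<close>

lemma psd_nonsingular_imp_coercive:
  fixes S :: "real mat"
  assumes S: "S \<in> carrier_mat n n" and sym: "transpose_mat S = S"
    and psd: "\<And>v. v \<in> carrier_vec n \<Longrightarrow> 0 \<le> v \<bullet> (S *\<^sub>v v)"
    and det: "det S \<noteq> 0"
  obtains \<delta> where "\<delta> > 0" "\<And>v. v \<in> carrier_vec n \<Longrightarrow> \<delta> * (v \<bullet> v) \<le> v \<bullet> (S *\<^sub>v v)"
proof -
  obtain B where B: "B \<in> carrier_mat n n" "S * B = 1\<^sub>m n"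
    using mat_inverse_of_det_nonzero[OF S det] by blast
  obtain C where C: "C > 0" "\<And>v. v \<in> carrier_vec n \<Longrightarrow> v \<bullet> (B *\<^sub>v v) \<le> C * (v \<bullet> v)"
    using quadratic_form_bound[OF B(1)] by blast
  show thesis
  proof
    show "1 / C > 0"
      using C by simp
    fix v :: "real vec"
    assume v: "v \<in> carrier_vec n"
    define u where "u = B *\<^sub>v v"
    have u: "u \<in> carrier_vec n"
      using B v by (simp add: u_def)
    have Su: "S *\<^sub>v u = v"
      using S B v unfolding u_def by (metis assoc_mult_mat_vec one_mult_mat_vec)
    \<comment> \<open>Positivity at \<open>w\<close> is the claim, because \<open>S u = v\<close> and \<open>u \<bullet> v \<le> C (v \<bullet> v)\<close>.\<close>
    define w where "w = v - (1 / C) \<cdot>\<^sub>v u"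
    have w: "w \<in> carrier_vec n"
      using u v by (simp add: w_def)
    have Sw: "S *\<^sub>v w = S *\<^sub>v v - (1 / C) \<cdot>\<^sub>v v"
      using S u v by (simp add: w_def mult_minus_distrib_mat_vec mult_mat_vec Su)
    have "0 \<le> w \<bullet> (S *\<^sub>v w)"
      using psd w .
    also have "\<dots> = v \<bullet> (S *\<^sub>v v) - (1 / C) * (v \<bullet> v)
        - (1 / C) * (u \<bullet> (S *\<^sub>v v)) + (1 / C)\<^sup>2 * (u \<bullet> v)"
      unfolding Sw using S u v
      by (simp add: w_def minus_scalar_prod_distrib[of _ n] scalar_prod_minus_distrib[of _ n]
          power2_eq_square algebra_simps)
    also have "u \<bullet> (S *\<^sub>v v) = v \<bullet> v"
      using mat_symmetric_form[OF S sym u v] by (simp add: Su)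
    also have "u \<bullet> v = v \<bullet> (B *\<^sub>v v)"
      using u v by (simp add: u_def comm_scalar_prod[of _ n])
    also have "(1 / C)\<^sup>2 * (v \<bullet> (B *\<^sub>v v)) \<le> (1 / C)\<^sup>2 * (C * (v \<bullet> v))"
      using C(2)[OF v] by (intro mult_left_mono) auto
    also have "(1 / C)\<^sup>2 * (C * (v \<bullet> v)) = (1 / C) * (v \<bullet> v)"
      using C(1) by (simp add: power2_eq_square)
    finally show "1 / C * (v \<bullet> v) \<le> v \<bullet> (S *\<^sub>v v)"
      by simp
  qed
qed

lemma symmetric_quadratic_form_le_eigval:
  fixes G :: "real mat"
  assumes G: "G \<in> carrier_mat n n" and sym: "transpose_mat G = G" and n: "n > 0"
  obtains \<mu> where "\<mu> \<in># eigvals G" "\<And>v. v \<in> carrier_vec n \<Longrightarrow> v \<bullet> (G *\<^sub>v v) \<le> \<mu> * (v \<bullet> v)"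
proof -
  \<comment> \<open>At the least \<open>\<mu>\<close> with \<open>\<mu> I - G\<close> positive semidefinite, that matrix must be singular: otherwise
    it would be coercive and \<open>\<mu>\<close> could be decreased.\<close>
  define Q where "Q = {l. \<forall>v \<in> carrier_vec n. v \<bullet> (G *\<^sub>v v) \<le> l * (v \<bullet> v)}"
  have form: "v \<bullet> ((l \<cdot>\<^sub>m 1\<^sub>m n - G) *\<^sub>v v) = l * (v \<bullet> v) - v \<bullet> (G *\<^sub>v v)"
    and app: "(l \<cdot>\<^sub>m 1\<^sub>m n - G) *\<^sub>v v = l \<cdot>\<^sub>v v - G *\<^sub>v v"
    if "v \<in> carrier_vec n" for l and v :: "real vec"
  proof -
    have "row (l \<cdot>\<^sub>m 1\<^sub>m n - G) i = l \<cdot>\<^sub>v unit_vec n i - row G i" if "i < n" for i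
      using G that by (intro eq_vecI) auto
    then show *: "(l \<cdot>\<^sub>m 1\<^sub>m n - G) *\<^sub>v v = l \<cdot>\<^sub>v v - G *\<^sub>v v"
      using G that by (intro eq_vecI) (auto simp: minus_scalar_prod_distrib[of _ n])
    show "v \<bullet> ((l \<cdot>\<^sub>m 1\<^sub>m n - G) *\<^sub>v v) = l * (v \<bullet> v) - v \<bullet> (G *\<^sub>v v)"
      unfolding * using G that by (simp add: scalar_prod_minus_distrib[of _ n])
  qed
  define e :: "real vec" where "e = unit_vec n 0"
  have e: "e \<in> carrier_vec n" "e \<bullet> e = 1"
    using n by (auto simp: e_def)
  obtain C where "C > 0" "\<And>v. v \<in> carrier_vec n \<Longrightarrow> v \<bullet> (G *\<^sub>v v) \<le> C * (v \<bullet> v)"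
    using quadratic_form_bound[OF G] by blast
  then have "Q \<noteq> {}"
    by (auto simp: Q_def)
  \<comment> \<open>A unit vector exists because \<open>n > 0\<close>. Its Rayleigh quotient bounds
    \<open>Q\<close> from below, so the infimum \<open>\<mu>\<close> is genuine.\<close>
  have low: "e \<bullet> (G *\<^sub>v e) \<le> l" if "l \<in> Q" for l
    using that e by (auto simp: Q_def dest!: bspec[of _ _ e])
  then have bdd: "bdd_below Q"
    by (rule bdd_belowI)
  define \<mu> where "\<mu> = Inf Q"
  \<comment> \<open>The infimum is attained: every Rayleigh quotient is a lower bound of
    \<open>Q\<close>, hence at most \<open>Inf Q\<close>.\<close>
  have le: "v \<bullet> (G *\<^sub>v v) \<le> \<mu> * (v \<bullet> v)" if v: "v \<in> carrier_vec n" for v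
  proof (cases "v = 0\<^sub>v n")
    case False
    have "v \<bullet> (G *\<^sub>v v) / (v \<bullet> v) \<le> \<mu>"
      unfolding \<mu>_def using \<open>Q \<noteq> {}\<close> v scalar_prod_self_pos[OF v False]
      by (intro cInf_greatest) (auto simp: Q_def divide_simps)
    then show ?thesis
      using scalar_prod_self_pos[OF v False] by (simp add: divide_simps)
  qed (use G in auto)
  define S where "S = \<mu> \<cdot>\<^sub>m 1\<^sub>m n - G"
  have S: "S \<in> carrier_mat n n"
    using G by (auto simp: S_def)
  have "transpose_mat (\<mu> \<cdot>\<^sub>m 1\<^sub>m n) = \<mu> \<cdot>\<^sub>m 1\<^sub>m n"
    by (intro eq_matI) auto
  then have "transpose_mat S = S"
    using G sym by (simp add: S_def transpose_minus[of _ n n])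
  have "det S = 0"
  proof (rule ccontr)
    assume "det S \<noteq> 0"
    obtain \<delta> where \<delta>: "\<delta> > 0" "\<And>v. v \<in> carrier_vec n \<Longrightarrow> \<delta> * (v \<bullet> v) \<le> v \<bullet> (S *\<^sub>v v)"
      using psd_nonsingular_imp_coercive[OF S \<open>transpose_mat S = S\<close> _ \<open>det S \<noteq> 0\<close>] le
      by (auto simp: S_def form)
    then have "\<mu> - \<delta> \<in> Q"
      by (force simp: Q_def S_def form algebra_simps)
    then have "\<mu> \<le> \<mu> - \<delta>"
      unfolding \<mu>_def using bdd by (intro cInf_lower)
    with \<delta>(1) show False
      by simp
  qed
  then obtain v where v: "v \<in> carrier_vec n" "v \<noteq> 0\<^sub>v n" "S *\<^sub>v v = 0\<^sub>v n"
    using det_0_iff_vec_prod_zero_field[OF S] by auto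
  have "G *\<^sub>v v = \<mu> \<cdot>\<^sub>v v"
  proof (rule eq_vecI)
    fix i assume "i < dim_vec (\<mu> \<cdot>\<^sub>v v)"
    then have "i < n"
      using v by simp
    then show "(G *\<^sub>v v) $ i = (\<mu> \<cdot>\<^sub>v v) $ i"
      using arg_cong[OF v(3), of "\<lambda>u. u $ i"] G v(1) by (simp add: S_def app)
  qed (use G v in auto)
  then have "eigenvector G v \<mu>"
    using G v by (simp add: eigenvector_def)
  then have "\<mu> \<in># eigvals G"
    using set_eigvals[OF G] by (auto simp: eigenvalue_def)
  with le show thesis
    using that by blast
qed

section \<open>Orthogonal projection onto the solutions of a linear system\<close>

text \<open>The correction \<open>d\<close> lies in the range of the transpose of \<open>X\<close>,
  hence is orthogonal to the kernel of \<open>X\<close>, in which any two solutions differ.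
  Pythagoras then makes \<open>w + d\<close> the unique closest solution. The closed form shows that
  an update is affine in \<open>w\<close> and \<open>y\<close>.\<close>

lemma arg_min_projection_affine:
  assumes X: "X \<in> carrier_mat n p" and w: "w \<in> carrier_vec p" and y: "y \<in> carrier_vec n"
    and B: "B \<in> carrier_mat n n" "X * transpose_mat X * B = 1\<^sub>m n"
  shows "arg_min (\<lambda>v. sq_dist v w) (\<lambda>v. v \<in> carrier_vec p \<and> X *\<^sub>v v = y)
    = w + transpose_mat X *\<^sub>v (B *\<^sub>v (y - X *\<^sub>v w))" (is "?min = _")
    and "X *\<^sub>v (w + transpose_mat X *\<^sub>v (B *\<^sub>v (y - X *\<^sub>v w))) = y"
proof -
  define z where "z = B *\<^sub>v (y - X *\<^sub>v w)"
  define d where "d = transpose_mat X *\<^sub>v z"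
  have z: "z \<in> carrier_vec n" and d: "d \<in> carrier_vec p"
    using X w y B by (auto simp: z_def d_def)
  have XXT: "X * transpose_mat X \<in> carrier_mat n n" and r: "y - X *\<^sub>v w \<in> carrier_vec n"
    using X w y by auto
  have "X *\<^sub>v d = (X * transpose_mat X) *\<^sub>v z"
    using X z by (simp add: d_def)
  also have "\<dots> = (X * transpose_mat X * B) *\<^sub>v (y - X *\<^sub>v w)"
    unfolding z_def using assoc_mult_mat_vec[OF XXT B(1) r] by (rule sym)
  finally have Xd: "X *\<^sub>v d = y - X *\<^sub>v w"
    using B r by simp
  have feasible: "X *\<^sub>v (w + d) = y"
    using X w d y by (simp add: mult_add_distrib_mat_vec Xd) (intro eq_vecI; auto)
  have pythagoras: "sq_dist v w = sq_dist (w + d) w + sq_dist v (w + d)"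
    if v: "v \<in> carrier_vec p" "X *\<^sub>v v = y" for v
  proof -
    define u where "u = v - (w + d)"
    have u: "u \<in> carrier_vec p"
      using v w d by (simp add: u_def)
    have "X *\<^sub>v u = 0\<^sub>v n"
      using X w d v y feasible by (simp add: u_def mult_minus_distrib_mat_vec[of _ n p])
    then have "d \<bullet> u = 0"
      unfolding d_def using transpose_vec_mult_scalar[OF X u z] z by simp
    then have ud: "u \<bullet> d = 0"
      using comm_scalar_prod[OF u d] by simp
    have vw: "v - w = d + u" and wd: "(w + d) - w = d"
      using v w d by (auto simp: u_def)
    have "sq_dist v w = (d + u) \<bullet> (d + u)"
      by (simp only: sq_dist_def vw)
    also have "\<dots> = d \<bullet> d + u \<bullet> u"
      using u d \<open>d \<bullet> u = 0\<close> ud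
      by (simp add: add_scalar_prod_distrib[of _ p] scalar_prod_add_distrib[of _ p])
    also have "\<dots> = sq_dist (w + d) w + sq_dist v (w + d)"
      by (simp only: sq_dist_def wd u_def)
    finally show ?thesis .
  qed
  \<comment> \<open>Uniqueness matters because \<open>arg_min\<close> selects an arbitrary
    minimiser: to evaluate it, every minimiser must be shown equal to \<open>w + d\<close>.\<close>
  have eq: "v = w + d" if "v \<in> carrier_vec p" "sq_dist v (w + d) \<le> 0" for v
  proof -
    have diff: "v - (w + d) \<in> carrier_vec p"
      using that w d by simp
    have "v - (w + d) = 0\<^sub>v p"
      using scalar_prod_self_pos[OF diff] that(2) by (auto simp: sq_dist_def)
    then have "v $ i = w $ i + d $ i" if "i < p" for i
      using \<open>v \<in> carrier_vec p\<close> w d that by (auto dest!: arg_cong[of _ _ "\<lambda>u. u $ i"])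
    then show ?thesis
      using that(1) w d by (intro eq_vecI) auto
  qed
  have "arg_min (\<lambda>v. sq_dist v w) (\<lambda>v. v \<in> carrier_vec p \<and> X *\<^sub>v v = y) = w + d"
  proof (rule arg_minI[where x = "w + d"])
    show "w + d \<in> carrier_vec p \<and> X *\<^sub>v (w + d) = y"
      using w d feasible by simp
    show "\<not> sq_dist v w < sq_dist (w + d) w" if "v \<in> carrier_vec p \<and> X *\<^sub>v v = y" for v
    proof -
      have "sq_dist v (w + d) \<ge> 0"
        by (simp add: sq_dist_def scalar_prod_self_nonneg)
      with pythagoras[of v] that show ?thesis
        by simp
    qed
    fix v
    assume v: "v \<in> carrier_vec p \<and> X *\<^sub>v v = y"
      and opt: "\<forall>u. u \<in> carrier_vec p \<and> X *\<^sub>v u = y \<longrightarrow> \<not> sq_dist u w < sq_dist v w"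
    have "sq_dist v w \<le> sq_dist (w + d) w"
      using opt[rule_format, of "w + d"] w d feasible by (simp add: not_less)
    with v pythagoras[of v] show "v = w + d"
      by (intro eq) auto
  qed
  then show "?min = w + transpose_mat X *\<^sub>v (B *\<^sub>v (y - X *\<^sub>v w))"
    by (simp add: d_def z_def)
  show "X *\<^sub>v (w + transpose_mat X *\<^sub>v (B *\<^sub>v (y - X *\<^sub>v w))) = y"
    using feasible by (simp add: d_def z_def)
qed

section \<open>Square-integrable random variables and vectors\<close>

text \<open>Membership in L2. Measurability of \<open>f\<close> is a separate conjunct because it
  does not follow from integrability of the square.\<close>

definition square_integrable :: "'a measure \<Rightarrow> ('a \<Rightarrow> real) \<Rightarrow> bool" where
  "square_integrable M f \<longleftrightarrow> f \<in> borel_measurable M \<and> integrable M (\<lambda>x. (f x)\<^sup>2)"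

lemma square_integrable_add:
  assumes "square_integrable M f" "square_integrable M g"
  shows "square_integrable M (\<lambda>x. f x + g x)"
proof -
  have "integrable M (\<lambda>x. (f x + g x)\<^sup>2)"
  proof (rule Bochner_Integration.integrable_bound)
    show "integrable M (\<lambda>x. 2 * (f x)\<^sup>2 + 2 * (g x)\<^sup>2)"
      using assms by (auto simp: square_integrable_def)
    show "(\<lambda>x. (f x + g x)\<^sup>2) \<in> borel_measurable M"
      using assms by (auto simp: square_integrable_def)
    have "(a + b)\<^sup>2 \<le> 2 * a\<^sup>2 + 2 * b\<^sup>2" for a b :: real
      using sum_squares_bound[of a b] by (simp add: power2_sum)
    then show "AE x in M. norm ((f x + g x)\<^sup>2) \<le> norm (2 * (f x)\<^sup>2 + 2 * (g x)\<^sup>2)"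
      by simp
  qed
  then show ?thesis
    using assms by (auto simp: square_integrable_def)
qed

lemma square_integrable_mult_left:
  "square_integrable M f \<Longrightarrow> square_integrable M (\<lambda>x. c * f x)"
  by (auto simp: square_integrable_def power_mult_distrib)

lemma square_integrable_diff:
  assumes "square_integrable M f" "square_integrable M g"
  shows "square_integrable M (\<lambda>x. f x - g x)"
  using square_integrable_add[OF assms(1) square_integrable_mult_left[OF assms(2), of "-1"]] by simp

lemma square_integrable_const: "finite_measure M \<Longrightarrow> square_integrable M (\<lambda>x. c)"
  by (simp add: square_integrable_def finite_measure.integrable_const)

lemma square_integrable_sum:
  assumes "finite_measure M" "\<And>i. i \<in> I \<Longrightarrow> square_integrable M (f i)"
  shows "square_integrable M (\<lambda>x. \<Sum>i\<in>I. f i x)"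
  using assms(2)
  by (induction I rule: infinite_finite_induct)
    (auto intro: square_integrable_add square_integrable_const[OF assms(1)])

text \<open>The dimension is fixed at every point, not just almost everywhere, so that the vector
  operations can be evaluated entry by entry for each outcome.\<close>

definition square_integrable_vec :: "'a measure \<Rightarrow> nat \<Rightarrow> ('a \<Rightarrow> real vec) \<Rightarrow> bool" where
  "square_integrable_vec M n f \<longleftrightarrow>
    (\<forall>x. f x \<in> carrier_vec n) \<and> (\<forall>i<n. square_integrable M (\<lambda>x. f x $ i))"

lemma square_integrable_vec_dim: "square_integrable_vec M n f \<Longrightarrow> dim_vec (f x) = n"
  by (simp add: square_integrable_vec_def carrier_vecD)

lemma square_integrable_vec_add:
  assumes "square_integrable_vec M n f" "square_integrable_vec M n g"
  shows "square_integrable_vec M n (\<lambda>x. f x + g x)"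
  using assms
  by (auto simp: square_integrable_vec_def square_integrable_vec_dim[OF assms(1)]
      square_integrable_vec_dim[OF assms(2)] square_integrable_add)

lemma square_integrable_vec_diff:
  assumes "square_integrable_vec M n f" "square_integrable_vec M n g"
  shows "square_integrable_vec M n (\<lambda>x. f x - g x)"
  using assms
  by (auto simp: square_integrable_vec_def square_integrable_vec_dim[OF assms(1)]
      square_integrable_vec_dim[OF assms(2)] square_integrable_diff)

lemma square_integrable_vec_const:
  assumes "finite_measure M" "v \<in> carrier_vec n"
  shows "square_integrable_vec M n (\<lambda>x. v)"
  using assms by (auto simp: square_integrable_vec_def square_integrable_const)

lemma square_integrable_vec_mult_mat_vec:
  assumes M: "finite_measure M" and A: "A \<in> carrier_mat m n" and f: "square_integrable_vec M n f"
  shows "square_integrable_vec M m (\<lambda>x. A *\<^sub>v f x)"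
proof -
  have fc: "dim_vec (f x) = n" for x
    using f by (rule square_integrable_vec_dim)
  have "square_integrable M (\<lambda>x. (A *\<^sub>v f x) $ i)" if "i < m" for i
  proof -
    have "square_integrable M (\<lambda>x. \<Sum>j = 0..<n. A $$ (i, j) * f x $ j)"
      using f by (intro square_integrable_sum[OF M] square_integrable_mult_left)
        (auto simp: square_integrable_vec_def)
    then show ?thesis
      using that A by (simp add: scalar_prod_def fc)
  qed
  then show ?thesis
    using A f by (auto simp: square_integrable_vec_def)
qed

lemma integrable_scalar_prod_self:
  assumes "square_integrable_vec M n f"
  shows "integrable M (\<lambda>x. f x \<bullet> f x)"
  using assms
  by (auto simp: square_integrable_vec_dim[OF assms] square_integrable_vec_def square_integrable_def scalar_prod_def
      simp flip: power2_eq_square intro!: Bochner_Integration.integrable_sum)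

section \<open>The Gram form of the error and the risk bound\<close>

text \<open>Moving \<open>X\<close> across the scalar product gives the form of the transpose of
  \<open>X\<close> times \<open>X\<close>; the factor \<open>n\<close> undoes the normalisation in
  \<open>gram_cov\<close>. This relates the noise norm to the spectrum of the covariance.\<close>

lemma scalar_prod_gram_cov:
  assumes X: "X \<in> carrier_mat n p" and n: "n > 0" and v: "v \<in> carrier_vec p"
  shows "(X *\<^sub>v v) \<bullet> (X *\<^sub>v v) = real n * (v \<bullet> (gram_cov X *\<^sub>v v))"
proof -
  have "gram_cov X *\<^sub>v v = (1 / real n) \<cdot>\<^sub>v ((transpose_mat X * X) *\<^sub>v v)"
  proof -
    have "(c \<cdot>\<^sub>m P) *\<^sub>v v = c \<cdot>\<^sub>v (P *\<^sub>v v)" if "P \<in> carrier_mat p p" for c :: real and P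
      using that v by (intro eq_vecI) auto
    from this[of "transpose_mat X * X"] show ?thesis
      using X by (auto simp: gram_cov_def)
  qed
  also have "(transpose_mat X * X) *\<^sub>v v = transpose_mat X *\<^sub>v (X *\<^sub>v v)"
    using X v by simp
  finally have "gram_cov X *\<^sub>v v = (1 / real n) \<cdot>\<^sub>v (transpose_mat X *\<^sub>v (X *\<^sub>v v))" .
  then have "v \<bullet> (gram_cov X *\<^sub>v v) = (1 / real n) * (v \<bullet> (transpose_mat X *\<^sub>v (X *\<^sub>v v)))"
    using X v by simp
  also have "v \<bullet> (transpose_mat X *\<^sub>v (X *\<^sub>v v)) = (X *\<^sub>v v) \<bullet> (X *\<^sub>v v)"
    using transpose_vec_mult_scalar[OF X v, of "X *\<^sub>v v"] X v by (simp add: comm_scalar_prod[of _ p])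
  finally show ?thesis
    using n by simp
qed

theorem theorem3p1:
  fixes M :: "'a measure"
    and T p t :: nat
    and n :: "nat \<Rightarrow> nat"
    and X :: "nat \<Rightarrow> real Matrix.mat"
    and w_star :: "real Matrix.vec"
    and \<epsilon> :: "nat \<Rightarrow> nat \<Rightarrow> 'a \<Rightarrow> real"
    and \<sigma> :: real
  assumes "prob_space M"
    and "\<And>s. s \<in> {1..T} \<Longrightarrow> n s \<ge> 1"
    and "\<And>s. s \<in> {1..T} \<Longrightarrow> X s \<in> carrier_mat (n s) p"
    and "w_star \<in> carrier_vec p"
    and "prob_space.indep_vars M (\<lambda>_. borel) (\<lambda>(s, i). \<epsilon> s i) (SIGMA s:{1..T}. {..<n s})"
    and "\<And>s i. s \<in> {1..T} \<Longrightarrow> i < n s \<Longrightarrow> integrable M (\<epsilon> s i)"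
    and "\<And>s i. s \<in> {1..T} \<Longrightarrow> i < n s \<Longrightarrow> integrable M (\<lambda>\<omega>. (\<epsilon> s i \<omega>)\<^sup>2)"
    and "\<And>s i. s \<in> {1..T} \<Longrightarrow> i < n s \<Longrightarrow> prob_space.expectation M (\<epsilon> s i) = 0"
    and "\<And>s i. s \<in> {1..T} \<Longrightarrow> i < n s \<Longrightarrow> prob_space.variance M (\<epsilon> s i) = \<sigma>\<^sup>2"
    and "\<sigma>\<^sup>2 > 0"
    and "t \<in> {1..T}"
    and "\<And>s. s \<in> {1..t} \<Longrightarrow> size {#\<gamma> \<in># eigvals (gram_cov (X s)). \<gamma> > 0#} = n s \<and> n s < p"
  shows "risk M w_star (\<lambda>\<omega>. mn_estimator p X (response X w_star \<epsilon> \<omega>) t)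
           \<ge> \<sigma>\<^sup>2 / Max (set_mset (eigvals (gram_cov (X t))))"
proof -
  interpret prob_space M by fact
  note X = assms(3) and ws = assms(4)
  define y where "y s \<omega> = response X w_star \<epsilon> \<omega> s" for s \<omega>
  define w where "w s \<omega> = mn_estimator p X (response X w_star \<epsilon> \<omega>) s" for s \<omega>
  have noise: "square_integrable_vec M (n s) (\<lambda>\<omega>. Matrix.vec (n s) (\<lambda>i. \<epsilon> s i \<omega>))"
    if "s \<in> {1..T}" for s
    using assms(6,7)[OF that] by (auto simp: square_integrable_vec_def square_integrable_def)
  have y_eq: "y s \<omega> = X s *\<^sub>v w_star + Matrix.vec (n s) (\<lambda>i. \<epsilon> s i \<omega>)" if "s \<in> {1..T}" for s \<omega>
    using X[OF that] by (simp add: y_def response_def)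
  have y_sq: "square_integrable_vec M (n s) (y s)" if "s \<in> {1..T}" for s
    unfolding y_eq[OF that, abs_def] using X[OF that] ws
    by (intro square_integrable_vec_add noise that square_integrable_vec_const
        finite_measure_axioms) auto
  \<comment> \<open>The matrix \<open>B\<close> is chosen before the outcome
    \<open>\<omega>\<close>: it depends only on the design, so each update is an affine map with
    deterministic coefficients.\<close>
  have w_step: "\<exists>B \<in> carrier_mat (n (Suc s)) (n (Suc s)). \<forall>\<omega>.
      w (Suc s) \<omega> = w s \<omega> + transpose_mat (X (Suc s)) *\<^sub>v
        (B *\<^sub>v (y (Suc s) \<omega> - X (Suc s) *\<^sub>v w s \<omega>)) \<and>
      X (Suc s) *\<^sub>v w (Suc s) \<omega> = y (Suc s) \<omega>"
    if s: "Suc s \<in> {1..t}" and w: "\<And>\<omega>. w s \<omega> \<in> carrier_vec p" for s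
  proof -
    have sT: "Suc s \<in> {1..T}"
      using s assms(11) by auto
    have XXT: "X (Suc s) * transpose_mat (X (Suc s)) \<in> carrier_mat (n (Suc s)) (n (Suc s))"
      using X[OF sT] by auto
    have "det (X (Suc s) * transpose_mat (X (Suc s))) \<noteq> 0"
      using det_row_gram_nonzero[OF X[OF sT]] assms(12)[OF s] by simp
    then obtain B where B: "B \<in> carrier_mat (n (Suc s)) (n (Suc s))"
        "X (Suc s) * transpose_mat (X (Suc s)) * B = 1\<^sub>m (n (Suc s))"
      using mat_inverse_of_det_nonzero[OF XXT] by blast
    have yc: "y (Suc s) \<omega> \<in> carrier_vec (n (Suc s))" for \<omega>
      using y_sq[OF sT] by (simp add: square_integrable_vec_def)
    have step: "w (Suc s) \<omega> = w s \<omega> + transpose_mat (X (Suc s)) *\<^sub>v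
        (B *\<^sub>v (y (Suc s) \<omega> - X (Suc s) *\<^sub>v w s \<omega>))" for \<omega>
      using arg_min_projection_affine(1)[OF X[OF sT] w yc B] by (simp add: w_def y_def)
    moreover have "X (Suc s) *\<^sub>v w (Suc s) \<omega> = y (Suc s) \<omega>" for \<omega>
      unfolding step by (rule arg_min_projection_affine(2)[OF X[OF sT] w yc B])
    ultimately show ?thesis
      using B(1) by blast
  qed
  have w_sq: "square_integrable_vec M p (w s)" if "s \<le> t" for s
    using that
  proof (induction s)
    case 0
    show ?case
      unfolding w_def by (auto intro: square_integrable_vec_const finite_measure_axioms)
  next
    case (Suc s)
    then have sT: "Suc s \<in> {1..T}" and st: "Suc s \<in> {1..t}"
      using assms(11) by auto
    have IH: "square_integrable_vec M p (w s)"
      using Suc by simp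
    then obtain B where B: "B \<in> carrier_mat (n (Suc s)) (n (Suc s))"
      and step: "\<And>\<omega>. w (Suc s) \<omega> = w s \<omega> + transpose_mat (X (Suc s)) *\<^sub>v
        (B *\<^sub>v (y (Suc s) \<omega> - X (Suc s) *\<^sub>v w s \<omega>))"
      using w_step[OF st] by (auto simp: square_integrable_vec_def)
    have XT: "transpose_mat (X (Suc s)) \<in> carrier_mat p (n (Suc s))"
      using X[OF sT] by simp
    show ?case
      \<comment> \<open>Deterministic matrices, sums and differences preserve square integrability,
        so it passes from \<open>w s\<close> and the response to \<open>w (Suc s)\<close>.\<close>
      unfolding step[abs_def]
      by (intro square_integrable_vec_add IH square_integrable_vec_diff y_sq sT
          square_integrable_vec_mult_mat_vec[OF finite_measure_axioms XT]
          square_integrable_vec_mult_mat_vec[OF finite_measure_axioms B]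
          square_integrable_vec_mult_mat_vec[OF finite_measure_axioms X[OF sT]])
  qed
  have w_carrier: "w s \<omega> \<in> carrier_vec p" if "s \<le> t" for s \<omega>
    using w_sq[OF that] by (simp add: square_integrable_vec_def)
  have tt: "t \<in> {1..t}" and t1: "Suc (t - 1) = t"
    using assms(11) by auto
  note Xt = X[OF assms(11)]
  define N where "N \<omega> = Matrix.vec (n t) (\<lambda>i. \<epsilon> t i \<omega>)" for \<omega>
  \<comment> \<open>The update is stated for successors; since \<open>t\<close> is at least 1, it
    applies at \<open>t - 1\<close> and yields the constraint of task \<open>t\<close>
    itself.\<close>
  have interpolates: "X t *\<^sub>v w t \<omega> = y t \<omega>" for \<omega>
    using w_step[of "t - 1", unfolded t1, OF tt w_carrier] by auto
  have error: "X t *\<^sub>v (w t \<omega> - w_star) = N \<omega>" for \<omega>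
  proof -
    have "X t *\<^sub>v (w t \<omega> - w_star) = y t \<omega> - X t *\<^sub>v w_star"
      using Xt ws w_carrier[of t \<omega>] by (simp add: mult_minus_distrib_mat_vec interpolates)
    also have "\<dots> = N \<omega>"
      using Xt ws by (auto simp: y_eq[OF assms(11)] N_def)
    finally show ?thesis .
  qed
  let ?G = "gram_cov (X t)"
  define L where "L = Max (set_mset (eigvals ?G))"
  have G: "?G \<in> carrier_mat p p"
    using Xt by (auto simp: gram_cov_def)
  have Gsym: "transpose_mat ?G = ?G"
    using Xt by (auto simp: gram_cov_def comm_scalar_prod[of _ "n t"])
  have "p > 0" and nt: "n t > 0"
    using assms(12)[OF tt] assms(2)[OF assms(11)] by auto
  obtain \<mu> where \<mu>: "\<mu> \<in># eigvals ?G"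
      "\<And>v. v \<in> carrier_vec p \<Longrightarrow> v \<bullet> (?G *\<^sub>v v) \<le> \<mu> * (v \<bullet> v)"
    using symmetric_quadratic_form_le_eigval[OF G Gsym \<open>p > 0\<close>] by blast
  have "\<mu> \<le> L"
    using \<mu>(1) by (simp add: L_def)
  \<comment> \<open>Task \<open>t\<close> has at least one sample, hence at least one positive
    eigenvalue. This makes \<open>L\<close> positive, as the final division by \<open>L\<close>
    requires.\<close>
  have "{#\<gamma> \<in># eigvals ?G. \<gamma> > 0#} \<noteq> {#}"
    unfolding nonempty_has_size using assms(12)[OF tt] nt by linarith
  then obtain \<gamma> where "\<gamma> \<in># eigvals ?G" "\<gamma> > 0"
    by auto
  then have "L > 0"
    unfolding L_def by (meson Max_ge finite_set_mset less_le_trans)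
  have bound: "N \<omega> \<bullet> N \<omega> \<le> real (n t) * L * sq_dist (w t \<omega>) w_star" for \<omega>
  proof -
    have e: "w t \<omega> - w_star \<in> carrier_vec p"
      using ws w_carrier[of t \<omega>] by simp
    have "N \<omega> \<bullet> N \<omega> = real (n t) * ((w t \<omega> - w_star) \<bullet> (?G *\<^sub>v (w t \<omega> - w_star)))"
      using scalar_prod_gram_cov[OF Xt nt e] by (simp add: error)
    also have "\<dots> \<le> real (n t) * (L * sq_dist (w t \<omega>) w_star)"
      unfolding sq_dist_def using \<mu>(2)[OF e] \<open>\<mu> \<le> L\<close> scalar_prod_self_nonneg[of "w t \<omega> - w_star"]
      by (intro mult_left_mono) (auto intro: order_trans mult_right_mono)
    finally show ?thesis
      by (simp add: mult.assoc)
  qed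
  \<comment> \<open>The noise has mean zero, so its variance is its second moment; summing over the
    samples of task \<open>t\<close> gives the expected squared noise norm.\<close>
  have "real (n t) * \<sigma>\<^sup>2 = (\<Sum>i<n t. expectation (\<lambda>\<omega>. (\<epsilon> t i \<omega>)\<^sup>2))"
    using assms(8,9)[OF assms(11)] by simp
  also have "\<dots> = expectation (\<lambda>\<omega>. N \<omega> \<bullet> N \<omega>)"
    using assms(7)[OF assms(11)]
    by (simp add: N_def scalar_prod_def atLeast0LessThan flip: power2_eq_square)
  also have "\<dots> \<le> expectation (\<lambda>\<omega>. real (n t) * L * sq_dist (w t \<omega>) w_star)"
  proof (rule integral_mono)
    show "integrable M (\<lambda>\<omega>. N \<omega> \<bullet> N \<omega>)"
      unfolding N_def by (rule integrable_scalar_prod_self[OF noise[OF assms(11)]])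
    \<comment> \<open>Here \<open>w_sq\<close> enters: monotonicity of the integral requires the
      squared error to be integrable as well.\<close>
    have "square_integrable_vec M p (\<lambda>\<omega>. w t \<omega> - w_star)"
      by (intro square_integrable_vec_diff w_sq square_integrable_vec_const
          finite_measure_axioms ws order_refl)
    then show "integrable M (\<lambda>\<omega>. real (n t) * L * sq_dist (w t \<omega>) w_star)"
      unfolding sq_dist_def by (intro integrable_mult_right integrable_scalar_prod_self)
  qed (rule bound)
  also have "\<dots> = real (n t) * (L * risk M w_star (w t))"
    by (simp add: risk_def)
  finally have "\<sigma>\<^sup>2 \<le> L * risk M w_star (w t)"
    using nt by simp
  then show ?thesis
    using \<open>L > 0\<close> unfolding L_def[symmetric] w_def[abs_def] by (simp add: divide_simps mult.commute)
qed

end
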